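(* Let $\Gamma$ be a countable set. Let $\{X_\gamma\}_{\gamma\in\Gamma}$ be a family of Banach spaces, each $X_\gamma$ equipped with a linear Hausdorff topology $\mathfrak{T}_\gamma$ coarser than the norm topology of $X_\gamma$, and let $\mathcal{E}$ be a Banach sequence space on $\Gamma$ equipped with a linear Hausdorff topology $\mathfrak{T}_{\mathcal{E}}$ coarser than the norm topology of $\mathcal{E}$. Suppose that (A1) the closed unit ball $\mathrm{Ball}(\mathcal{E})$ is sequentially closed with respect to the point-wise topology, i.e. if $x\in\omega(\Gamma)$ is the point-wise limit of a sequence from $\mathrm{Ball}(\mathcal{E})$, then $x\in\mathrm{Ball}(\mathcal{E})$; (A2) the space $(\bigoplus_{\gamma\in\Gamma}X_\gamma)_{\mathcal{E}}$ is equipped with a $\oplus$-compatible topology $\mathfrak{T}$; (A3) for positive sequences on the unit sphere of $\mathcal{E}$ the topology $\mathfrak{T}_{\mathcal{E}}$ agrees with the topology of point-wise convergence (i.e. for positive norm-one $x_n,x\in\mathcal{E}$, $x_n\to x$ in $\mathfrak{T}_{\mathcal{E}}$ if and only if $x_n\to x$ point-wise); (A4) for every $\gamma\in\Gamma$ the norm function $x\mapsto\|x\|_{X_\gamma}$ is sequentially lower semi-continuous with respect to $\mathfrak{T}_\gamma$. Then the mapping $\lfloor\bullet\rceil\colon(\bigoplus_{\gamma\in\Gamma}X_\gamma)_{\mathcal{E}}\to\mathcal{E}$, $\lfloor x\rceil=\sum_{\gamma\in\Gamma}\|x(\gamma)\|_{X_\gamma}\boldsymbol{e}_\gamma$, is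 $\mathfrak{T}$-to-$\mathfrak{T}_{\mathcal{E}}$ sequentially continuous when restricted to the unit sphere if, and only if, the set $\Gamma$ can be decomposed into two disjoint subsets $\Gamma_1$ and $\Gamma_2$ such that every $X_\gamma$ with $\gamma\in\Gamma_1$ has the Schur property with respect to $\mathfrak{T}_\gamma$ and $\mathcal{E}$ is $\mathbf{SM}(\gamma)$ for every $\gamma\in\Gamma_2$.
   Context: Conventions: unless stated otherwise, Banach spaces are real and infinite-dimensional. "Coarser" is meant in the non-strict sense. A linear topology is a vector space topology. $\omega(\Gamma)$ is the space of all real functions on $\Gamma$. Banach sequence space on a countable set $\Gamma$: a Banach space $X$ that is a linear subspace of $\omega(\Gamma)$, contains the characteristic functions of all finite subsets of $\Gamma$, and has the ideal property: if $|x(\gamma)|\le|y(\gamma)|$ for all $\gamma\in\Gamma$ and $y\in X$, then $x\in X$ and $\|x\|\le\|y\|$. $X_+$ denotes the nonnegative elements of $X$; $\boldsymbol{e}_\gamma$ is the $\gamma$-th unit vector. Direct sum: $(\bigoplus_{\gamma\in\Gamma}X_\gamma)_{\mathcal{E}}$ is the Banach space of all $x=\{x(\gamma)\}_{\gamma\in\Gamma}\in\prod_{\gamma}X_\gamma$ with $\sum_{\gamma}\|x(\gamma)\|_{X_\gamma}\boldsymbol{e}_\gamma\in\mathcal{E}$, with coordinate-wise operations and norm $\|x\|=\big\|\sum_{\gamma}\|x(\gamma)\|_{X_\gamma}\boldsymbol{e}_\gamma\big\|_{\mathcal{E}}$. Maps: $\pi_\gamma(x)=x(\gamma)$ is the projection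 of the direct sum onto $X_\gamma$; $j_\gamma\colon X_\gamma\to(\bigoplus X_\gamma)_{\mathcal{E}}$ places a vector in the $\gamma$-th coordinate and $0$ elsewhere; $j_{\mathcal{E}}\colon\mathcal{E}\to(\bigoplus X_\gamma)_{\mathcal{E}}$ is $j_{\mathcal{E}}(a)=\{a(\gamma)x_\gamma\}_{\gamma\in\Gamma}$, where $\{x_\gamma\}_{\gamma\in\Gamma}$, $x_\gamma\in X_\gamma$, $\|x_\gamma\|=1$, is a sequence of norm-one vectors fixed once and for all. $\oplus$-compatible topology: a linear Hausdorff topology $\mathfrak{T}$ on $(\bigoplus X_\gamma)_{\mathcal{E}}$ is $\oplus$-compatible (with the $\mathfrak{T}_\gamma$ and $\mathfrak{T}_{\mathcal{E}}$) if (C1) $\mathfrak{T}$ is coarser than the norm topology; (C2) each $\pi_\gamma$ is $\mathfrak{T}$-to-$\mathfrak{T}_\gamma$ sequentially continuous; (C3) each $j_\gamma$ is $\mathfrak{T}_\gamma$-to-$\mathfrak{T}$ sequentially continuous; (C4) $j_{\mathcal{E}}$ is $\mathfrak{T}_{\mathcal{E}}$-to-$\mathfrak{T}$ sequentially continuous. Sequential lower semi-continuity of $f\colon X\to\mathbb{R}$ with respect to $\mathfrak{T}$: $x_n\to x$ in $\mathfrak{T}$ implies $f(x)\le\liminf_n f(x_n)$. Schur property with respect to $\mathfrak{T}$: every sequence in $X$ converging to some $x\in X$ in $\mathfrak{T}$ converges to $x$ in norm. $\mathbf{SM}(\gamma_0)$: a Banach sequence space $X$ on $\Gamma$ is $\mathbf{SM}(\gamma_0)$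 if for all $x,y\in X_+$ with $x(\gamma)\le y(\gamma)$ for $\gamma\ne\gamma_0$ and $x(\gamma_0)<y(\gamma_0)$ one has $\|x\|<\|y\|$. *)

theory Defs
  imports "HOL-Analysis.Analysis" "HOL-Library.Function_Algebras"
begin

instantiation "fun" :: (type, real_vector) real_vector
begin

definition scaleR_fun :: "real \<Rightarrow> ('a \<Rightarrow> 'b) \<Rightarrow> 'a \<Rightarrow> 'b" where
  "scaleR_fun c f = (\<lambda>x. c *\<^sub>R f x)"

instance
  by standard (simp_all add: scaleR_fun_def fun_eq_iff scaleR_add_right scaleR_add_left)

end

(* A normed space is a linear subspace X of some real vector space together with a norm N on X.
   The values of N outside X are irrelevant. A family of Banach spaces is a family of subspaces of
   one vector space, each with its own norm; this is no restriction, since any family of vector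
   spaces embeds in its algebraic direct sum. *)

definition norm_on :: "'a::real_vector set \<Rightarrow> ('a \<Rightarrow> real) \<Rightarrow> bool" where
  "norm_on X N \<longleftrightarrow>
     (\<forall>x\<in>X. 0 \<le> N x) \<and>
     (\<forall>x\<in>X. N x = 0 \<longleftrightarrow> x = 0) \<and>
     (\<forall>x\<in>X. \<forall>c. N (c *\<^sub>R x) = \<bar>c\<bar> * N x) \<and>
     (\<forall>x\<in>X. \<forall>y\<in>X. N (x + y) \<le> N x + N y)"

(* Cut off outside X because the locale Metric_space demands a nonnegative symmetric
   function on the whole type. *)
definition norm_dist :: "'a::real_vector set \<Rightarrow> ('a \<Rightarrow> real) \<Rightarrow> 'a \<Rightarrow> 'a \<Rightarrow> real" where
  "norm_dist X N x y = (if x \<in> X \<and> y \<in> X then N (x - y) else 0)"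

definition norm_topology :: "'a::real_vector set \<Rightarrow> ('a \<Rightarrow> real) \<Rightarrow> 'a topology" where
  "norm_topology X N = Metric_space.mtopology X (norm_dist X N)"

(* By convention all Banach spaces are real and infinite-dimensional. *)
definition banach_space_on :: "'a::real_vector set \<Rightarrow> ('a \<Rightarrow> real) \<Rightarrow> bool" where
  "banach_space_on X N \<longleftrightarrow>
     subspace X \<and> norm_on X N \<and> Metric_space.mcomplete X (norm_dist X N) \<and>
     \<not> (\<exists>B. finite B \<and> X \<subseteq> span B)"

lemma Metric_space_norm_dist:
  assumes "subspace X" "norm_on X N"
  shows "Metric_space X (norm_dist X N)"
proof
  have diff: "x - y \<in> X" if "x \<in> X" "y \<in> X" for x y
    using assms(1) that by (rule subspace_diff)
  have nonneg: "0 \<le> N x" if "x \<in> X" for x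
    using assms(2) that by (simp add: norm_on_def)
  have zero: "N x = 0 \<longleftrightarrow> x = 0" if "x \<in> X" for x
    using assms(2) that by (simp add: norm_on_def)
  have scale: "N (c *\<^sub>R x) = \<bar>c\<bar> * N x" if "x \<in> X" for c x
    using assms(2) that by (simp add: norm_on_def)
  have triangle: "N (x + y) \<le> N x + N y" if "x \<in> X" "y \<in> X" for x y
    using assms(2) that by (simp add: norm_on_def)
  show "0 \<le> norm_dist X N x y" for x y
    by (simp add: norm_dist_def nonneg diff)
  show "norm_dist X N x y = norm_dist X N y x" for x y
    using scale[of "x - y" "-1"] diff[of x y] by (simp add: norm_dist_def)
  show "norm_dist X N x y = 0 \<longleftrightarrow> x = y" if "x \<in> X" "y \<in> X" for x y
    using that zero[OF diff[OF that]] by (simp add: norm_dist_def)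
  show "norm_dist X N x z \<le> norm_dist X N x y + norm_dist X N y z"
    if "x \<in> X" "y \<in> X" "z \<in> X" for x y z
    using that triangle[OF diff[of x y] diff[of y z]] by (simp add: norm_dist_def)
qed

definition unit_sphere :: "'a set \<Rightarrow> ('a \<Rightarrow> real) \<Rightarrow> 'a set" where
  "unit_sphere X N = {x \<in> X. N x = 1}"

definition unit_ball :: "'a set \<Rightarrow> ('a \<Rightarrow> real) \<Rightarrow> 'a set" where
  "unit_ball X N = {x \<in> X. N x \<le> 1}"

definition coarser :: "'a topology \<Rightarrow> 'a topology \<Rightarrow> bool" where
  "coarser S T \<longleftrightarrow> topspace S = topspace T \<and> (\<forall>U. openin S U \<longrightarrow> openin T U)"

definition linear_topology_on :: "'a::real_vector set \<Rightarrow> 'a topology \<Rightarrow> bool" where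
  "linear_topology_on X T \<longleftrightarrow>
     topspace T = X \<and>
     continuous_map (prod_topology T T) T (\<lambda>(x, y). x + y) \<and>
     continuous_map (prod_topology euclideanreal T) T (\<lambda>(c, x). c *\<^sub>R x)"

definition seq_continuous_map :: "'a topology \<Rightarrow> 'b topology \<Rightarrow> ('a \<Rightarrow> 'b) \<Rightarrow> bool" where
  "seq_continuous_map S T f \<longleftrightarrow>
     (\<forall>xs x. range xs \<subseteq> topspace S \<and> limitin S xs x sequentially
        \<longrightarrow> limitin T (\<lambda>n. f (xs n)) (f x) sequentially)"

definition seq_lower_semicontinuous :: "'a topology \<Rightarrow> ('a \<Rightarrow> real) \<Rightarrow> bool" where
  "seq_lower_semicontinuous T f \<longleftrightarrow>
     (\<forall>xs x. range xs \<subseteq> topspace T \<and> limitin T xs x sequentially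
        \<longrightarrow> ereal (f x) \<le> liminf (\<lambda>n. ereal (f (xs n))))"

definition Schur_property ::
    "'a::real_vector set \<Rightarrow> ('a \<Rightarrow> real) \<Rightarrow> 'a topology \<Rightarrow> bool" where
  "Schur_property X N T \<longleftrightarrow>
     (\<forall>xs x. range xs \<subseteq> X \<and> x \<in> X \<and> limitin T xs x sequentially
        \<longrightarrow> limitin (norm_topology X N) xs x sequentially)"

(* A real function on \<Gamma> is represented by its extension by zero. *)
definition omega :: "'g set \<Rightarrow> ('g \<Rightarrow> real) set" where
  "omega \<Gamma> = {x. \<forall>\<gamma>. \<gamma> \<notin> \<Gamma> \<longrightarrow> x \<gamma> = 0}"

definition banach_sequence_space ::
    "'g set \<Rightarrow> ('g \<Rightarrow> real) set \<Rightarrow> (('g \<Rightarrow> real) \<Rightarrow> real) \<Rightarrow> bool" where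
  "banach_sequence_space \<Gamma> E NE \<longleftrightarrow>
     banach_space_on E NE \<and> E \<subseteq> omega \<Gamma> \<and>
     (\<forall>A. finite A \<and> A \<subseteq> \<Gamma> \<longrightarrow> indicator A \<in> E) \<and>
     (\<forall>x\<in>omega \<Gamma>. \<forall>y\<in>E. (\<forall>\<gamma>\<in>\<Gamma>. \<bar>x \<gamma>\<bar> \<le> \<bar>y \<gamma>\<bar>) \<longrightarrow> x \<in> E \<and> NE x \<le> NE y)"

definition positive_cone :: "'g set \<Rightarrow> ('g \<Rightarrow> real) set \<Rightarrow> ('g \<Rightarrow> real) set" where
  "positive_cone \<Gamma> E = {x \<in> E. \<forall>\<gamma>\<in>\<Gamma>. 0 \<le> x \<gamma>}"

definition pointwise_limit :: "'g set \<Rightarrow> (nat \<Rightarrow> 'g \<Rightarrow> real) \<Rightarrow> ('g \<Rightarrow> real) \<Rightarrow> bool" where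
  "pointwise_limit \<Gamma> xs x \<longleftrightarrow> (\<forall>\<gamma>\<in>\<Gamma>. (\<lambda>n. xs n \<gamma>) \<longlonglongrightarrow> x \<gamma>)"

definition SM ::
    "'g set \<Rightarrow> ('g \<Rightarrow> real) set \<Rightarrow> (('g \<Rightarrow> real) \<Rightarrow> real) \<Rightarrow> 'g \<Rightarrow> bool" where
  "SM \<Gamma> E NE \<gamma>0 \<longleftrightarrow>
     (\<forall>x\<in>positive_cone \<Gamma> E. \<forall>y\<in>positive_cone \<Gamma> E.
        (\<forall>\<gamma>\<in>\<Gamma>. \<gamma> \<noteq> \<gamma>0 \<longrightarrow> x \<gamma> \<le> y \<gamma>) \<and> x \<gamma>0 < y \<gamma>0 \<longrightarrow> NE x < NE y)"

(* The formal sum over \<gamma> of N \<gamma> (x \<gamma>) times the unit vector at \<gamma>, that is, the function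
   with values N \<gamma> (x \<gamma>). *)
definition norm_map :: "'g set \<Rightarrow> ('g \<Rightarrow> 'a \<Rightarrow> real) \<Rightarrow> ('g \<Rightarrow> 'a) \<Rightarrow> 'g \<Rightarrow> real" where
  "norm_map \<Gamma> N x = (\<lambda>\<gamma>. if \<gamma> \<in> \<Gamma> then N \<gamma> (x \<gamma>) else 0)"

definition direct_sum ::
    "'g set \<Rightarrow> ('g \<Rightarrow> 'a::real_vector set) \<Rightarrow> ('g \<Rightarrow> 'a \<Rightarrow> real) \<Rightarrow> ('g \<Rightarrow> real) set
      \<Rightarrow> ('g \<Rightarrow> 'a) set" where
  "direct_sum \<Gamma> X N E =
     {x. (\<forall>\<gamma>\<in>\<Gamma>. x \<gamma> \<in> X \<gamma>) \<and> (\<forall>\<gamma>. \<gamma> \<notin> \<Gamma> \<longrightarrow> x \<gamma> = 0) \<and> norm_map \<Gamma> N x \<in> E}"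

definition direct_sum_norm ::
    "'g set \<Rightarrow> ('g \<Rightarrow> 'a \<Rightarrow> real) \<Rightarrow> (('g \<Rightarrow> real) \<Rightarrow> real) \<Rightarrow> ('g \<Rightarrow> 'a) \<Rightarrow> real" where
  "direct_sum_norm \<Gamma> N NE x = NE (norm_map \<Gamma> N x)"

definition coord_proj :: "'g \<Rightarrow> ('g \<Rightarrow> 'a) \<Rightarrow> 'a" where
  "coord_proj \<gamma> x = x \<gamma>"

definition coord_inj :: "'g \<Rightarrow> 'a::zero \<Rightarrow> 'g \<Rightarrow> 'a" where
  "coord_inj \<gamma> v = (\<lambda>\<delta>. if \<delta> = \<gamma> then v else 0)"

definition seq_inj :: "'g set \<Rightarrow> ('g \<Rightarrow> 'a::real_vector) \<Rightarrow> ('g \<Rightarrow> real) \<Rightarrow> 'g \<Rightarrow> 'a" where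
  "seq_inj \<Gamma> u a = (\<lambda>\<gamma>. if \<gamma> \<in> \<Gamma> then a \<gamma> *\<^sub>R u \<gamma> else 0)"

(* u is the fixed family of norm-one vectors used in seq_inj. *)
definition oplus_compatible ::
    "'g set \<Rightarrow> ('g \<Rightarrow> 'a::real_vector set) \<Rightarrow> ('g \<Rightarrow> 'a \<Rightarrow> real) \<Rightarrow> ('g \<Rightarrow> 'a topology)
      \<Rightarrow> ('g \<Rightarrow> real) set \<Rightarrow> (('g \<Rightarrow> real) \<Rightarrow> real) \<Rightarrow> ('g \<Rightarrow> real) topology
      \<Rightarrow> ('g \<Rightarrow> 'a) \<Rightarrow> ('g \<Rightarrow> 'a) topology \<Rightarrow> bool" where
  "oplus_compatible \<Gamma> X N TX E NE TE u T \<longleftrightarrow>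
     linear_topology_on (direct_sum \<Gamma> X N E) T \<and> Hausdorff_space T \<and>
     coarser T (norm_topology (direct_sum \<Gamma> X N E) (direct_sum_norm \<Gamma> N NE)) \<and>
     (\<forall>\<gamma>\<in>\<Gamma>. seq_continuous_map T (TX \<gamma>) (coord_proj \<gamma>)) \<and>
     (\<forall>\<gamma>\<in>\<Gamma>. seq_continuous_map (TX \<gamma>) T (coord_inj \<gamma>)) \<and>
     seq_continuous_map TE T (seq_inj \<Gamma> u)"

end

theory Submission
  imports Defs
begin

text \<open>
Two mechanisms are at work, one in the summands and one in \<open>E\<close>.

Sufficiency. Let \<open>x n\<close> tend to \<open>x\<close> in \<open>T\<close> on the unit sphere. By A3 it suffices to show that
the norms of the coordinates converge. Where \<open>X \<gamma>\<close> has the Schur property this is immediate. At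
every coordinate lower semicontinuity bounds the norm of the limit by the limit inferior of the
norms, so convergence can fail only if the norms are too large along a subsequence. If this
happens at a coordinate \<open>\<gamma>0\<close> where \<open>E\<close> is \<open>SM\<close>, then cutting the norm sequences down to the norms of \<open>x\<close> at all coordinates except
\<open>\<gamma>0\<close>, and to a slightly larger constant at \<open>\<gamma>0\<close>, yields elements of the unit ball converging
pointwise to a function that exceeds \<open>norm_map \<Gamma> N x\<close> at \<open>\<gamma>0\<close> only. By A1 this function has norm
at most one, whereas \<open>SM\<close> says that its norm exceeds one (\<open>SM_tendsto\<close>).

Necessity. Take for \<open>\<Gamma>1\<close> the set of all coordinates with the Schur property and suppose that
\<open>E\<close> is not \<open>SM\<close> at some other \<open>\<gamma>0\<close>. Then some positive unit vector \<open>z\<close> can be enlarged at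
\<open>\<gamma>0\<close> to a value \<open>b\<close> without changing its norm (\<open>not_SM_enlarge\<close>). Without the Schur property
there is a null sequence \<open>h\<close> for \<open>TX \<gamma>0\<close> such that adding \<open>h n\<close> to \<open>z \<gamma>0 *\<^sub>R u \<gamma>0\<close> raises
its norm to exactly \<open>b\<close> (\<open>not_Schur_norm_jump\<close>). Hence \<open>seq_inj \<Gamma> u z + coord_inj \<gamma>0 (h n)\<close>
stays on the unit sphere and tends to \<open>seq_inj \<Gamma> u z\<close>, while the coordinate norm at \<open>\<gamma>0\<close> jumps
from \<open>b\<close> down to \<open>z \<gamma>0\<close>. By A3 the norm map is then not sequentially continuous.
\<close>

section \<open>Normed subspaces and linear topologies\<close>

lemma norm_on_nonneg:
  assumes "norm_on X N" "x \<in> X"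
  shows "0 \<le> N x"
  using assms by (simp add: norm_on_def)

lemma norm_on_scaleR:
  assumes "norm_on X N" "x \<in> X"
  shows "N (c *\<^sub>R x) = \<bar>c\<bar> * N x"
  using assms by (simp add: norm_on_def)

lemma norm_on_abs_diff_le:
  assumes X: "subspace X" and N: "norm_on X N" and x: "x \<in> X" and y: "y \<in> X"
  shows "\<bar>N x - N y\<bar> \<le> N (x - y)"
proof -
  have tri: "N (a + b) \<le> N a + N b" if "a \<in> X" "b \<in> X" for a b
    using N that by (simp add: norm_on_def)
  have d: "x - y \<in> X" "y - x \<in> X"
    using X x y by (auto intro: subspace_diff)
  have "N (y - x) = N (x - y)"
    using norm_on_scaleR[OF N d(1), of "-1"] by simp
  then show ?thesis
    using tri[OF d(1) y] tri[OF d(2) x] by simp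
qed

lemma limitin_norm_topology_iff:
  assumes "subspace X" "norm_on X N" and "range xs \<subseteq> X" "x \<in> X"
  shows "limitin (norm_topology X N) xs x sequentially \<longleftrightarrow> (\<lambda>n. N (xs n - x)) \<longlonglongrightarrow> 0"
proof -
  interpret Metric_space X "norm_dist X N"
    using assms by (intro Metric_space_norm_dist)
  have xs: "xs n \<in> X" for n
    using assms by auto
  have "0 \<le> N (xs n - x)" for n
    using assms xs by (intro norm_on_nonneg[of X] subspace_diff)
  then show ?thesis
    using assms xs by (simp add: norm_topology_def limit_metric_sequentially norm_dist_def LIMSEQ_def)
qed

lemma limitin_norm_tendsto:
  assumes X: "subspace X" and N: "norm_on X N" and xs: "range xs \<subseteq> X" "x \<in> X"
    and lim: "limitin (norm_topology X N) xs x sequentially"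
  shows "(\<lambda>n. N (xs n)) \<longlonglongrightarrow> N x"
proof (rule LIM_zero_cancel, rule Lim_null_comparison)
  show "\<forall>\<^sub>F n in sequentially. norm (N (xs n) - N x) \<le> N (xs n - x)"
    using xs by (auto intro!: always_eventually norm_on_abs_diff_le[OF X N])
  show "(\<lambda>n. N (xs n - x)) \<longlonglongrightarrow> 0"
    using lim limitin_norm_topology_iff[OF X N xs] by simp
qed

lemma limitin_add:
  assumes T: "linear_topology_on X T"
    and f: "limitin T f a F" and g: "limitin T g b F"
  shows "limitin T (\<lambda>n. f n + g n) (a + b) F"
proof -
  have "limitin (prod_topology T T) (\<lambda>n. (f n, g n)) (a, b) F"
    using f g by (simp add: limitin_pairwise o_def)
  from continuous_map_limit[OF _ this, of T "\<lambda>(x, y). x + y"] show ?thesis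
    using T by (simp add: linear_topology_on_def o_def)
qed

lemma limitin_scaleR:
  assumes T: "linear_topology_on X T"
    and c: "(c \<longlongrightarrow> r) F" and f: "limitin T f a F"
  shows "limitin T (\<lambda>n. c n *\<^sub>R f n) (r *\<^sub>R a) F"
proof -
  have "limitin (prod_topology euclideanreal T) (\<lambda>n. (c n, f n)) (r, a) F"
    using c f by (simp add: limitin_pairwise o_def)
  from continuous_map_limit[OF _ this, of T "\<lambda>(c, x). c *\<^sub>R x"] show ?thesis
    using T by (simp add: linear_topology_on_def o_def)
qed

text \<open>Linearity moves the limit to zero; a subsequence then stays away from zero in norm.\<close>

lemma not_Schur_null_sequence:
  assumes X: "subspace X" and N: "norm_on X N" and T: "linear_topology_on X T"
    and nS: "\<not> Schur_property X N T"
  obtains w \<epsilon> where "range w \<subseteq> X" "limitin T w 0 sequentially" "0 < \<epsilon>" "\<And>n. \<epsilon> \<le> N (w n)"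
proof -
  obtain xs x where xs: "range xs \<subseteq> X" and x: "x \<in> X"
    and lim: "limitin T xs x sequentially"
    and nlim: "\<not> limitin (norm_topology X N) xs x sequentially"
    using nS by (auto simp: Schur_property_def)
  define v where "v n = xs n - x" for n
  have vX: "v n \<in> X" for n
    using xs x X by (auto simp: v_def intro: subspace_diff)
  have "limitin T (\<lambda>n. - x) (- x) sequentially"
    using x X T by (auto simp: linear_topology_on_def subspace_neg)
  from limitin_add[OF T lim this] have v: "limitin T v 0 sequentially"
    by (simp add: v_def[abs_def])
  have "\<not> (\<lambda>n. N (v n)) \<longlonglongrightarrow> 0"
    using nlim limitin_norm_topology_iff[OF X N xs x] by (simp add: v_def)
  then obtain \<epsilon> where \<epsilon>: "0 < \<epsilon>" and "\<not> (\<forall>\<^sub>F n in sequentially. N (v n) < \<epsilon>)"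
    using norm_on_nonneg[OF N vX] by (auto simp: tendsto_iff)
  then have "infinite {n. \<epsilon> \<le> N (v n)}"
    by (simp add: cofinite_eq_sequentially[symmetric] eventually_cofinite not_less)
  from infinite_enumerate[OF this] obtain r :: "nat \<Rightarrow> nat"
    where r: "strict_mono r" "\<And>n. \<epsilon> \<le> N (v (r n))"
    by auto
  show thesis
  proof (rule that)
    show "range (v \<circ> r) \<subseteq> X"
      using vX by auto
    show "limitin T (v \<circ> r) 0 sequentially"
      using r(1) v by (rule limitin_subsequence)
  qed (use \<epsilon> r(2) in auto)
qed

text \<open>
Since the vectors of the null sequence \<open>w\<close> are bounded away from zero in norm, moving from \<open>v\<close> in
the direction \<open>w n\<close> reaches norm \<open>b\<close> for a coefficient of \<open>w n\<close> that is bounded in \<open>n\<close>. So \<open>h n\<close> is a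
bounded multiple of \<open>w n\<close>, and along a subsequence with convergent multipliers joint continuity of
scalar multiplication keeps it null.
\<close>

lemma not_Schur_norm_jump:
  assumes X: "subspace X" and N: "norm_on X N" and T: "linear_topology_on X T"
    and nS: "\<not> Schur_property X N T" and v: "v \<in> X" "N v < b"
  obtains h where "range h \<subseteq> X" "limitin T h 0 sequentially" "\<And>n. N (v + h n) = b"
proof -
  obtain w \<epsilon> where w: "range w \<subseteq> X" "limitin T w 0 sequentially"
    and \<epsilon>: "0 < \<epsilon>" "\<And>n. \<epsilon> \<le> N (w n)"
    using not_Schur_null_sequence[OF X N T nS] by blast
  have wX: "w n \<in> X" for n
    using w(1) by auto
  have X': "v + s *\<^sub>R w n \<in> X" for s n
    using X v(1) wX by (intro subspace_add subspace_scale)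
  \<comment> \<open>At coefficient \<open>S\<close> the reverse triangle inequality gives norm at least \<open>b\<close>.\<close>
  define S where "S = (b + N v) / \<epsilon>"
  have S: "0 \<le> S"
    using \<epsilon>(1) v norm_on_nonneg[OF N v(1)] by (simp add: S_def)
  have "\<exists>s\<in>{0..S}. N (v + s *\<^sub>R w n) = b" for n
  proof -
    have lip: "\<bar>N (v + s *\<^sub>R w n) - N (v + t *\<^sub>R w n)\<bar> \<le> N (w n) * \<bar>s - t\<bar>" for s t
      using norm_on_abs_diff_le[OF X N X' X', of s n t n] norm_on_scaleR[OF N wX, of "s - t" n]
      by (simp add: algebra_simps)
    have "(N (w n))-lipschitz_on {0..S} (\<lambda>s. N (v + s *\<^sub>R w n))"
      using lip norm_on_nonneg[OF N wX] by (intro lipschitz_onI) (auto simp: dist_real_def)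
    then have cont: "continuous_on {0..S} (\<lambda>s. N (v + s *\<^sub>R w n))"
      by (rule lipschitz_on_continuous_on)
    have "S * N (w n) - N v \<le> N (v + S *\<^sub>R w n)"
    proof -
      have "- v \<in> X"
        using X v(1) by (rule subspace_neg)
      moreover have "N (- v) = N v"
        using norm_on_scaleR[OF N v(1), of "-1"] by simp
      moreover have "S *\<^sub>R w n \<in> X"
        using X wX by (rule subspace_scale)
      ultimately show ?thesis
        using norm_on_abs_diff_le[OF X N, of "S *\<^sub>R w n" "- v"] norm_on_scaleR[OF N wX, of S n] S
        by (simp add: add.commute)
    qed
    moreover have "b + N v \<le> S * N (w n)"
      using mult_left_mono[OF \<epsilon>(2) S, of n] \<epsilon>(1) by (simp add: S_def)
    ultimately have "b \<le> N (v + S *\<^sub>R w n)"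
      by simp
    then show ?thesis
      using IVT'[OF _ _ S cont, of b] v(2) by auto
  qed
  then obtain s where s: "\<And>n. s n \<in> {0..S}" "\<And>n. N (v + s n *\<^sub>R w n) = b"
    by metis
  obtain l r where r: "strict_mono (r :: nat \<Rightarrow> nat)" and l: "(s \<circ> r) \<longlonglongrightarrow> l"
    using seq_compactE[OF compact_imp_seq_compact[OF compact_Icc[of 0 S]], of s] s(1) by metis
  show thesis
  proof (rule that)
    show "range (\<lambda>n. s (r n) *\<^sub>R w (r n)) \<subseteq> X"
      using X wX by (auto intro: subspace_scale)
    show "limitin T (\<lambda>n. s (r n) *\<^sub>R w (r n)) 0 sequentially"
      using limitin_scaleR[OF T l limitin_subsequence[OF r w(2)]] by (simp add: o_def)
  qed (rule s(2))
qed

section \<open>Strict monotonicity in sequence spaces\<close>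

lemma banach_sequence_space_ideal:
  assumes "banach_sequence_space \<Gamma> E NE" "x \<in> omega \<Gamma>" "y \<in> E"
    and "\<And>\<gamma>. \<gamma> \<in> \<Gamma> \<Longrightarrow> \<bar>x \<gamma>\<bar> \<le> \<bar>y \<gamma>\<bar>"
  shows "x \<in> E" "NE x \<le> NE y"
  using assms unfolding banach_sequence_space_def by blast+

text \<open>
If \<open>x\<close> and \<open>y\<close> witness the failure of \<open>SM\<close>, then so do \<open>x\<close> and the function that takes the value
of \<open>y\<close> at \<open>\<gamma>0\<close> and agrees with \<open>x\<close> elsewhere, because it lies between them. The norm is
therefore constant on this pair, and it can be scaled to one.
\<close>

lemma not_SM_enlarge:
  assumes E: "banach_sequence_space \<Gamma> E NE" and \<gamma>0: "\<gamma>0 \<in> \<Gamma>" and nSM: "\<not> SM \<Gamma> E NE \<gamma>0"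
  obtains z b where "z \<in> positive_cone \<Gamma> E \<inter> unit_sphere E NE" "z \<gamma>0 < b"
    "z(\<gamma>0 := b) \<in> positive_cone \<Gamma> E \<inter> unit_sphere E NE"
proof -
  have sub: "subspace E" and NE: "norm_on E NE" and om: "E \<subseteq> omega \<Gamma>"
    using E by (auto simp: banach_sequence_space_def banach_space_on_def)
  obtain x y where x: "x \<in> positive_cone \<Gamma> E" and y: "y \<in> positive_cone \<Gamma> E"
    and le: "\<And>\<gamma>. \<gamma> \<in> \<Gamma> \<Longrightarrow> \<gamma> \<noteq> \<gamma>0 \<Longrightarrow> x \<gamma> \<le> y \<gamma>" and less: "x \<gamma>0 < y \<gamma>0"
    and ge: "NE y \<le> NE x"
    using nSM by (auto simp: SM_def not_less)
  have xE: "x \<in> E" and yE: "y \<in> E"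
    and xpos: "\<And>\<gamma>. \<gamma> \<in> \<Gamma> \<Longrightarrow> 0 \<le> x \<gamma>" and ypos: "\<And>\<gamma>. \<gamma> \<in> \<Gamma> \<Longrightarrow> 0 \<le> y \<gamma>"
    using x y by (auto simp: positive_cone_def)
  define x' where "x' = x(\<gamma>0 := y \<gamma>0)"
  have "x' \<in> omega \<Gamma>"
    using xE om \<gamma>0 by (auto simp: x'_def omega_def)
  moreover have "\<bar>x' \<gamma>\<bar> \<le> \<bar>y \<gamma>\<bar>" if "\<gamma> \<in> \<Gamma>" for \<gamma>
    using le[OF that] xpos[OF that] by (auto simp: x'_def)
  ultimately have x': "x' \<in> E" "NE x' \<le> NE y"
    using banach_sequence_space_ideal[OF E _ yE] by auto
  have "NE x \<le> NE x'"
  proof (rule banach_sequence_space_ideal(2)[OF E _ x'(1)])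
    show "x \<in> omega \<Gamma>"
      using xE om by auto
    show "\<bar>x \<gamma>\<bar> \<le> \<bar>x' \<gamma>\<bar>" if "\<gamma> \<in> \<Gamma>" for \<gamma>
      using xpos[OF that] less by (auto simp: x'_def)
  qed
  with ge x'(2) have eq: "NE x' = NE x"
    by simp
  have "y \<noteq> 0"
    using less xpos[OF \<gamma>0] by auto
  then have "0 < NE y"
    using NE yE by (auto simp: norm_on_def less_le)
  with ge have c: "0 < NE x"
    by simp
  define c where "c = inverse (NE x)"
  have cpos: "0 < c"
    using c by (simp add: c_def)
  have upd: "(c *\<^sub>R x)(\<gamma>0 := c * y \<gamma>0) = c *\<^sub>R x'"
    by (auto simp: x'_def scaleR_fun_def)
  show thesis
  proof (rule that)
    show "c *\<^sub>R x \<in> positive_cone \<Gamma> E \<inter> unit_sphere E NE"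
      using subspace_scale[OF sub xE] norm_on_scaleR[OF NE xE] cpos c xpos
      by (auto simp: positive_cone_def unit_sphere_def scaleR_fun_def c_def)
    show "(c *\<^sub>R x) \<gamma>0 < c * y \<gamma>0"
      using less cpos by (simp add: scaleR_fun_def)
    have "0 \<le> x' \<gamma>" if "\<gamma> \<in> \<Gamma>" for \<gamma>
      using that xpos ypos by (auto simp: x'_def)
    then show "(c *\<^sub>R x)(\<gamma>0 := c * y \<gamma>0) \<in> positive_cone \<Gamma> E \<inter> unit_sphere E NE"
      unfolding upd
      using subspace_scale[OF sub x'(1)] norm_on_scaleR[OF NE x'(1)] cpos c eq
      by (auto simp: positive_cone_def unit_sphere_def scaleR_fun_def c_def)
  qed
qed

lemma liminf_ge_imp_min_tendsto:
  fixes s :: "nat \<Rightarrow> real"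
  assumes "ereal a \<le> liminf (\<lambda>n. ereal (s n))"
  shows "(\<lambda>n. min (s n) a) \<longlonglongrightarrow> a"
proof (rule order_tendstoI)
  fix c assume "c < a"
  then have "\<forall>\<^sub>F n in sequentially. ereal c < ereal (s n)"
    using assms unfolding le_Liminf_iff by (meson less_ereal.simps(1))
  then show "\<forall>\<^sub>F n in sequentially. c < min (s n) a"
    using \<open>c < a\<close> by (auto elim: eventually_mono)
qed (simp add: min_less_iff_disj)

text \<open>
If \<open>zs n \<gamma>0\<close> does not tend to \<open>z \<gamma>0\<close>, it exceeds some \<open>z \<gamma>0 + \<epsilon>\<close> infinitely often. Truncating
these \<open>zs n\<close> from above by the function \<open>z(\<gamma>0 := z \<gamma>0 + \<epsilon>)\<close> keeps them in the ball and, by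
lower semicontinuity, makes them converge pointwise to it; closedness of the ball then contradicts
strict monotonicity.
\<close>

lemma SM_tendsto:
  assumes E: "banach_sequence_space \<Gamma> E NE" and \<gamma>0: "\<gamma>0 \<in> \<Gamma>" and SM: "SM \<Gamma> E NE \<gamma>0"
    and closed: "\<And>xs x. range xs \<subseteq> unit_ball E NE \<Longrightarrow> x \<in> omega \<Gamma> \<Longrightarrow> pointwise_limit \<Gamma> xs x
               \<Longrightarrow> x \<in> unit_ball E NE"
    and zs: "\<And>n. zs n \<in> positive_cone \<Gamma> E \<inter> unit_ball E NE"
    and z: "z \<in> positive_cone \<Gamma> E" "NE z = 1"
    and lsc: "\<And>\<gamma>. \<gamma> \<in> \<Gamma> \<Longrightarrow> ereal (z \<gamma>) \<le> liminf (\<lambda>n. ereal (zs n \<gamma>))"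
  shows "(\<lambda>n. zs n \<gamma>0) \<longlonglongrightarrow> z \<gamma>0"
proof (rule ccontr)
  assume ntends: "\<not> (\<lambda>n. zs n \<gamma>0) \<longlonglongrightarrow> z \<gamma>0"
  have mins: "(\<lambda>n. min (zs n \<gamma>) (z \<gamma>)) \<longlonglongrightarrow> z \<gamma>" if "\<gamma> \<in> \<Gamma>" for \<gamma>
    using lsc[OF that] by (rule liminf_ge_imp_min_tendsto)
  obtain c where c: "z \<gamma>0 < c" and "\<not> (\<forall>\<^sub>F n in sequentially. zs n \<gamma>0 < c)"
  proof -
    have "\<forall>\<^sub>F n in sequentially. d < zs n \<gamma>0" if "d < z \<gamma>0" for d
      using order_tendstoD(1)[OF mins[OF \<gamma>0] that] by (auto elim: eventually_mono)
    then show thesis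
      using ntends order_tendstoI[of "z \<gamma>0" "\<lambda>n. zs n \<gamma>0" sequentially] that by blast
  qed
  then have "infinite {n. c \<le> zs n \<gamma>0}"
    by (simp add: cofinite_eq_sequentially[symmetric] eventually_cofinite not_less)
  from infinite_enumerate[OF this] obtain r :: "nat \<Rightarrow> nat"
    where r: "strict_mono r" and large: "\<And>n. c \<le> zs (r n) \<gamma>0"
    by auto
  define y where "y = z(\<gamma>0 := c)"
  define ys where "ys n \<gamma> = min (zs (r n) \<gamma>) (y \<gamma>)" for n \<gamma>
  have om: "E \<subseteq> omega \<Gamma>"
    using E by (auto simp: banach_sequence_space_def)
  have zE: "z \<in> E" and zpos: "\<And>\<gamma>. \<gamma> \<in> \<Gamma> \<Longrightarrow> 0 \<le> z \<gamma>"
    using z by (auto simp: positive_cone_def)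
  have zsE: "zs n \<in> E" and zsN: "NE (zs n) \<le> 1" and zspos: "\<And>\<gamma>. \<gamma> \<in> \<Gamma> \<Longrightarrow> 0 \<le> zs n \<gamma>" for n
    using zs[of n] by (auto simp: positive_cone_def unit_ball_def)
  have yom: "y \<in> omega \<Gamma>" and ypos: "\<And>\<gamma>. \<gamma> \<in> \<Gamma> \<Longrightarrow> 0 \<le> y \<gamma>"
    using zE om \<gamma>0 zpos c order.trans[OF zpos[OF \<gamma>0] less_imp_le[OF c]]
    by (auto simp: y_def omega_def)
  have "ys n \<in> unit_ball E NE" for n
  proof -
    have "zs (r n) \<in> omega \<Gamma>"
      using zsE om by auto
    then have "ys n \<in> omega \<Gamma>"
      using yom by (auto simp: ys_def omega_def)
    from banach_sequence_space_ideal[OF E this zsE[of "r n"]]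
    have "ys n \<in> E" "NE (ys n) \<le> NE (zs (r n))"
      using zspos ypos by (auto simp: ys_def)
    with zsN[of "r n"] show ?thesis
      by (simp add: unit_ball_def)
  qed
  moreover have "pointwise_limit \<Gamma> ys y"
    unfolding pointwise_limit_def
  proof
    fix \<gamma> assume \<gamma>: "\<gamma> \<in> \<Gamma>"
    show "(\<lambda>n. ys n \<gamma>) \<longlonglongrightarrow> y \<gamma>"
    proof (cases "\<gamma> = \<gamma>0")
      case True
      then have "ys n \<gamma> = y \<gamma>" for n
        using large[of n] by (simp add: ys_def y_def)
      then show ?thesis
        by simp
    next
      case False
      then show ?thesis
        using LIMSEQ_subseq_LIMSEQ[OF mins[OF \<gamma>] r] by (simp add: ys_def y_def o_def)
    qed
  qed
  ultimately have "y \<in> unit_ball E NE"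
    using yom by (intro closed) auto
  then have "y \<in> positive_cone \<Gamma> E" "NE y \<le> 1"
    using ypos by (auto simp: unit_ball_def positive_cone_def)
  moreover have "NE z < NE y"
    using SM z(1) \<open>y \<in> positive_cone \<Gamma> E\<close> c by (auto simp: SM_def y_def)
  ultimately show False
    using z(2) by simp
qed

section \<open>The norm map on the unit sphere of a direct sum\<close>

lemma norm_map_sphere:
  assumes "\<And>\<gamma>. \<gamma> \<in> \<Gamma> \<Longrightarrow> norm_on (X \<gamma>) (N \<gamma>)"
    and "x \<in> unit_sphere (direct_sum \<Gamma> X N E) (direct_sum_norm \<Gamma> N NE)"
  shows "norm_map \<Gamma> N x \<in> positive_cone \<Gamma> E \<inter> unit_sphere E NE"
proof -
  have "0 \<le> N \<gamma> (x \<gamma>)" if "\<gamma> \<in> \<Gamma>" for \<gamma>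
    using assms(2) norm_on_nonneg[OF assms(1)[OF that]] that
    by (simp add: unit_sphere_def direct_sum_def)
  then have "0 \<le> norm_map \<Gamma> N x \<gamma>" for \<gamma>
    by (simp add: norm_map_def)
  then show ?thesis
    using assms(2)
    by (simp add: unit_sphere_def direct_sum_def direct_sum_norm_def positive_cone_def)
qed

theorem theorem3:
  fixes \<Gamma> :: "'g set"
    and X :: "'g \<Rightarrow> 'a::real_vector set"
    and N :: "'g \<Rightarrow> 'a \<Rightarrow> real"
    and TX :: "'g \<Rightarrow> 'a topology"
    and E :: "('g \<Rightarrow> real) set"
    and NE :: "('g \<Rightarrow> real) \<Rightarrow> real"
    and TE :: "('g \<Rightarrow> real) topology"
    and u :: "'g \<Rightarrow> 'a"
    and T :: "('g \<Rightarrow> 'a) topology"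
  assumes "countable \<Gamma>"
    and "\<And>\<gamma>. \<gamma> \<in> \<Gamma> \<Longrightarrow> banach_space_on (X \<gamma>) (N \<gamma>)"
    and "\<And>\<gamma>. \<gamma> \<in> \<Gamma> \<Longrightarrow> linear_topology_on (X \<gamma>) (TX \<gamma>)"
    and "\<And>\<gamma>. \<gamma> \<in> \<Gamma> \<Longrightarrow> Hausdorff_space (TX \<gamma>)"
    and "\<And>\<gamma>. \<gamma> \<in> \<Gamma> \<Longrightarrow> coarser (TX \<gamma>) (norm_topology (X \<gamma>) (N \<gamma>))"
    and "banach_sequence_space \<Gamma> E NE"
    and "linear_topology_on E TE"
    and "Hausdorff_space TE"
    and "coarser TE (norm_topology E NE)"
    and "\<And>\<gamma>. \<gamma> \<in> \<Gamma> \<Longrightarrow> u \<gamma> \<in> X \<gamma> \<and> N \<gamma> (u \<gamma>) = 1"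
    and A1: "\<And>xs x. range xs \<subseteq> unit_ball E NE \<Longrightarrow> x \<in> omega \<Gamma> \<Longrightarrow> pointwise_limit \<Gamma> xs x
               \<Longrightarrow> x \<in> unit_ball E NE"
    and A2: "oplus_compatible \<Gamma> X N TX E NE TE u T"
    and A3: "\<And>xs x. range xs \<subseteq> positive_cone \<Gamma> E \<inter> unit_sphere E NE
               \<Longrightarrow> x \<in> positive_cone \<Gamma> E \<inter> unit_sphere E NE
               \<Longrightarrow> limitin TE xs x sequentially \<longleftrightarrow> pointwise_limit \<Gamma> xs x"
    and A4: "\<And>\<gamma>. \<gamma> \<in> \<Gamma> \<Longrightarrow> seq_lower_semicontinuous (TX \<gamma>) (N \<gamma>)"
  shows "seq_continuous_map
           (subtopology T (unit_sphere (direct_sum \<Gamma> X N E) (direct_sum_norm \<Gamma> N NE)))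
           TE (norm_map \<Gamma> N)
    \<longleftrightarrow> (\<exists>\<Gamma>1 \<Gamma>2. \<Gamma>1 \<union> \<Gamma>2 = \<Gamma> \<and> \<Gamma>1 \<inter> \<Gamma>2 = {} \<and>
           (\<forall>\<gamma>\<in>\<Gamma>1. Schur_property (X \<gamma>) (N \<gamma>) (TX \<gamma>)) \<and>
           (\<forall>\<gamma>\<in>\<Gamma>2. SM \<Gamma> E NE \<gamma>))"
proof -
  let ?D = "direct_sum \<Gamma> X N E"
  let ?S = "unit_sphere ?D (direct_sum_norm \<Gamma> N NE)"
  note E = \<open>banach_sequence_space \<Gamma> E NE\<close>
  have Xsub: "subspace (X \<gamma>)" and XN: "norm_on (X \<gamma>) (N \<gamma>)" if "\<gamma> \<in> \<Gamma>" for \<gamma>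
    using assms(2)[OF that] by (auto simp: banach_space_on_def)
  have TXtop: "topspace (TX \<gamma>) = X \<gamma>" if "\<gamma> \<in> \<Gamma>" for \<gamma>
    using assms(3)[OF that] by (simp add: linear_topology_on_def)
  have T: "linear_topology_on ?D T"
    and proj: "\<And>\<gamma>. \<gamma> \<in> \<Gamma> \<Longrightarrow> seq_continuous_map T (TX \<gamma>) (coord_proj \<gamma>)"
    and inj: "\<And>\<gamma>. \<gamma> \<in> \<Gamma> \<Longrightarrow> seq_continuous_map (TX \<gamma>) T (coord_inj \<gamma>)"
    using A2 by (auto simp: oplus_compatible_def)
  have Ttop: "topspace T = ?D"
    using T by (simp add: linear_topology_on_def)
  note sphere = norm_map_sphere[of \<Gamma> X N _ E NE, OF XN]
  show ?thesis
  proof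
    assume cont: "seq_continuous_map (subtopology T ?S) TE (norm_map \<Gamma> N)"
    have "SM \<Gamma> E NE \<gamma>0" if \<gamma>0: "\<gamma>0 \<in> \<Gamma>" and nS: "\<not> Schur_property (X \<gamma>0) (N \<gamma>0) (TX \<gamma>0)" for \<gamma>0
    proof (rule ccontr)
      assume "\<not> SM \<Gamma> E NE \<gamma>0"
      then obtain z b where z: "z \<in> positive_cone \<Gamma> E \<inter> unit_sphere E NE" and b: "z \<gamma>0 < b"
        and zb: "z(\<gamma>0 := b) \<in> positive_cone \<Gamma> E \<inter> unit_sphere E NE"
        using not_SM_enlarge[OF E \<gamma>0] by blast
      have uX: "u \<gamma> \<in> X \<gamma>" "N \<gamma> (u \<gamma>) = 1" if "\<gamma> \<in> \<Gamma>" for \<gamma>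
        using assms(10)[OF that] by auto
      have zpos: "0 \<le> z \<gamma>" if "\<gamma> \<in> \<Gamma>" for \<gamma>
        using z that by (auto simp: positive_cone_def)
      have zout: "z \<gamma> = 0" if "\<gamma> \<notin> \<Gamma>" for \<gamma>
        using z E that by (auto simp: positive_cone_def banach_sequence_space_def omega_def)
      have zu: "z \<gamma> *\<^sub>R u \<gamma> \<in> X \<gamma>" "N \<gamma> (z \<gamma> *\<^sub>R u \<gamma>) = z \<gamma>" if "\<gamma> \<in> \<Gamma>" for \<gamma>
        using uX[OF that] Xsub[OF that] norm_on_scaleR[OF XN[OF that]] zpos[OF that]
        by (auto intro: subspace_scale)
      obtain h where h: "range h \<subseteq> X \<gamma>0" "limitin (TX \<gamma>0) h 0 sequentially"
        and hN: "\<And>n. N \<gamma>0 (z \<gamma>0 *\<^sub>R u \<gamma>0 + h n) = b"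
        using not_Schur_norm_jump[OF Xsub[OF \<gamma>0] XN[OF \<gamma>0] assms(3)[OF \<gamma>0] nS zu(1)[OF \<gamma>0], of b]
          zu(2)[OF \<gamma>0] b by auto
      define f where "f = seq_inj \<Gamma> u z"
      define g where "g n = f + coord_inj \<gamma>0 (h n)" for n
      have nf: "norm_map \<Gamma> N f = z"
        using zu(2) zout by (auto simp: norm_map_def f_def seq_inj_def)
      have ng: "norm_map \<Gamma> N (g n) = z(\<gamma>0 := b)" for n
        using zu(2) zout hN[of n] \<gamma>0
        by (auto simp: norm_map_def g_def f_def seq_inj_def coord_inj_def)
      have fS: "f \<in> ?S"
        using z nf zu(1)
        by (auto simp: unit_sphere_def direct_sum_def direct_sum_norm_def f_def seq_inj_def)
      have gS: "g n \<in> ?S" for n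
      proof -
        have "g n \<gamma> \<in> X \<gamma>" if "\<gamma> \<in> \<Gamma>" for \<gamma>
        proof (cases "\<gamma> = \<gamma>0")
          case True
          have "h n \<in> X \<gamma>0"
            using h(1) by auto
          with True show ?thesis
            using subspace_add[OF Xsub[OF \<gamma>0] zu(1)[OF \<gamma>0]] \<gamma>0
            by (simp add: g_def f_def seq_inj_def coord_inj_def)
        qed (use zu(1) that in \<open>auto simp: g_def f_def seq_inj_def coord_inj_def\<close>)
        moreover have "g n \<gamma> = 0" if "\<gamma> \<notin> \<Gamma>" for \<gamma>
          using that \<gamma>0 by (auto simp: g_def f_def seq_inj_def coord_inj_def)
        ultimately show ?thesis
          using zb ng[of n] by (simp add: unit_sphere_def direct_sum_def direct_sum_norm_def)
      qed
      have "limitin T (\<lambda>n. coord_inj \<gamma>0 (h n)) (coord_inj \<gamma>0 0) sequentially"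
        using inj[OF \<gamma>0] h TXtop[OF \<gamma>0] by (auto simp: seq_continuous_map_def)
      moreover have "coord_inj \<gamma>0 (0 :: 'a) = 0"
        by (auto simp: coord_inj_def)
      moreover have "limitin T (\<lambda>n. f) f sequentially"
        using fS Ttop by (simp add: unit_sphere_def)
      ultimately have "limitin T g f sequentially"
        using limitin_add[OF T, of "\<lambda>n. f" f sequentially "\<lambda>n. coord_inj \<gamma>0 (h n)" 0]
        by (simp add: g_def[abs_def])
      then have "limitin (subtopology T ?S) g f sequentially"
        using fS gS by (simp add: limitin_subtopology)
      moreover have "range g \<subseteq> topspace (subtopology T ?S)"
        using gS Ttop by (auto simp: unit_sphere_def)
      ultimately have "limitin TE (\<lambda>n. norm_map \<Gamma> N (g n)) (norm_map \<Gamma> N f) sequentially"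
        using cont by (auto simp: seq_continuous_map_def)
      then have "limitin TE (\<lambda>n. z(\<gamma>0 := b)) z sequentially"
        by (simp add: nf ng)
      then have "pointwise_limit \<Gamma> (\<lambda>n. z(\<gamma>0 := b)) z"
        using A3[of "\<lambda>n. z(\<gamma>0 := b)" z] z zb by auto
      then have "(\<lambda>n::nat. b) \<longlonglongrightarrow> z \<gamma>0"
        using \<gamma>0 by (auto simp: pointwise_limit_def)
      then show False
        using b by (simp add: LIMSEQ_const_iff)
    qed
    then show "\<exists>\<Gamma>1 \<Gamma>2. \<Gamma>1 \<union> \<Gamma>2 = \<Gamma> \<and> \<Gamma>1 \<inter> \<Gamma>2 = {} \<and>
        (\<forall>\<gamma>\<in>\<Gamma>1. Schur_property (X \<gamma>) (N \<gamma>) (TX \<gamma>)) \<and> (\<forall>\<gamma>\<in>\<Gamma>2. SM \<Gamma> E NE \<gamma>)"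
      by (intro exI[of _ "{\<gamma>\<in>\<Gamma>. Schur_property (X \<gamma>) (N \<gamma>) (TX \<gamma>)}"]
          exI[of _ "{\<gamma>\<in>\<Gamma>. \<not> Schur_property (X \<gamma>) (N \<gamma>) (TX \<gamma>)}"]) auto
  next
    assume "\<exists>\<Gamma>1 \<Gamma>2. \<Gamma>1 \<union> \<Gamma>2 = \<Gamma> \<and> \<Gamma>1 \<inter> \<Gamma>2 = {} \<and>
        (\<forall>\<gamma>\<in>\<Gamma>1. Schur_property (X \<gamma>) (N \<gamma>) (TX \<gamma>)) \<and> (\<forall>\<gamma>\<in>\<Gamma>2. SM \<Gamma> E NE \<gamma>)"
    then have dich: "Schur_property (X \<gamma>) (N \<gamma>) (TX \<gamma>) \<or> SM \<Gamma> E NE \<gamma>" if "\<gamma> \<in> \<Gamma>" for \<gamma>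
      using that by blast
    show "seq_continuous_map (subtopology T ?S) TE (norm_map \<Gamma> N)"
      unfolding seq_continuous_map_def
    proof (intro allI impI, elim conjE)
      fix xs x
      assume "range xs \<subseteq> topspace (subtopology T ?S)"
        and lim: "limitin (subtopology T ?S) xs x sequentially"
      then have xsS: "xs n \<in> ?S" for n
        by auto
      have xS: "x \<in> ?S" and xsx: "limitin T xs x sequentially"
        using lim by (auto simp: limitin_subtopology)
      have coordX: "xs n \<gamma> \<in> X \<gamma>" "x \<gamma> \<in> X \<gamma>" if "\<gamma> \<in> \<Gamma>" for n \<gamma>
        using xsS[of n] xS that by (auto simp: unit_sphere_def direct_sum_def)
      have coord: "limitin (TX \<gamma>) (\<lambda>n. xs n \<gamma>) (x \<gamma>) sequentially" if "\<gamma> \<in> \<Gamma>" for \<gamma>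
      proof -
        have "range xs \<subseteq> topspace T"
          using xsS Ttop by (auto simp: unit_sphere_def)
        then show ?thesis
          using proj[OF that] xsx by (auto simp: seq_continuous_map_def coord_proj_def)
      qed
      have lsc: "ereal (norm_map \<Gamma> N x \<gamma>) \<le> liminf (\<lambda>n. ereal (norm_map \<Gamma> N (xs n) \<gamma>))"
        if \<gamma>: "\<gamma> \<in> \<Gamma>" for \<gamma>
      proof -
        have "range (\<lambda>n. xs n \<gamma>) \<subseteq> topspace (TX \<gamma>)"
          using coordX(1)[OF \<gamma>] TXtop[OF \<gamma>] by auto
        then show ?thesis
          using A4[OF \<gamma>] coord[OF \<gamma>] \<gamma> by (simp add: seq_lower_semicontinuous_def norm_map_def)
      qed
      have "(\<lambda>n. norm_map \<Gamma> N (xs n) \<gamma>) \<longlonglongrightarrow> norm_map \<Gamma> N x \<gamma>" if \<gamma>: "\<gamma> \<in> \<Gamma>" for \<gamma>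
        using dich[OF \<gamma>]
      proof
        assume S: "Schur_property (X \<gamma>) (N \<gamma>) (TX \<gamma>)"
        have "range (\<lambda>n. xs n \<gamma>) \<subseteq> X \<gamma>"
          using coordX(1)[OF \<gamma>] by auto
        moreover from this have "limitin (norm_topology (X \<gamma>) (N \<gamma>)) (\<lambda>n. xs n \<gamma>) (x \<gamma>) sequentially"
          using S coord[OF \<gamma>] coordX(2)[OF \<gamma>] by (simp add: Schur_property_def)
        ultimately have "(\<lambda>n. N \<gamma> (xs n \<gamma>)) \<longlonglongrightarrow> N \<gamma> (x \<gamma>)"
          using limitin_norm_tendsto[OF Xsub[OF \<gamma>] XN[OF \<gamma>]] coordX(2)[OF \<gamma>] by blast
        with \<gamma> show ?thesis
          by (simp add: norm_map_def)
      next
        assume SM: "SM \<Gamma> E NE \<gamma>"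
        show ?thesis
        proof (rule SM_tendsto[OF E \<gamma> SM A1])
          show "norm_map \<Gamma> N (xs n) \<in> positive_cone \<Gamma> E \<inter> unit_ball E NE" for n
            using sphere[OF _ xsS[of n]] by (auto simp: unit_sphere_def unit_ball_def)
          show "norm_map \<Gamma> N x \<in> positive_cone \<Gamma> E" "NE (norm_map \<Gamma> N x) = 1"
            using sphere[OF _ xS] by (auto simp: unit_sphere_def)
        qed (use lsc in auto)
      qed
      then have "pointwise_limit \<Gamma> (\<lambda>n. norm_map \<Gamma> N (xs n)) (norm_map \<Gamma> N x)"
        by (simp add: pointwise_limit_def)
      moreover have "range (\<lambda>n. norm_map \<Gamma> N (xs n)) \<subseteq> positive_cone \<Gamma> E \<inter> unit_sphere E NE"
        using sphere[OF _ xsS] by blast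
      moreover have "norm_map \<Gamma> N x \<in> positive_cone \<Gamma> E \<inter> unit_sphere E NE"
        using sphere[OF _ xS] by blast
      ultimately show "limitin TE (\<lambda>n. norm_map \<Gamma> N (xs n)) (norm_map \<Gamma> N x) sequentially"
        using A3 by blast
    qed
  qed
qed

end
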